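(* Let $q\ge 2$. For every integer $n\ge 1$, the number $B_n(q)$ of symmetric $q$-ary strong lonesum $n\times n$ matrices equals $$1+\sum_{j=1}^{n}\ \sum_{(n_0,\ldots,n_j)\in\mathcal{S}_n^j}\binom{n}{n_0,n_1,\ldots,n_j}\left(\prod_{i=1}^{\lfloor j/2\rfloor}f_q(n_{2i-1},n_{2i})\right)\left(1+(q-2)\Big(n-\sum_{i=0}^{2\lfloor j/2\rfloor}n_i\Big)\right),$$ where $f_q(r,s)=1+(q-2)rs+r\big((q-1)^s-(q-2)s-1\big)+s\big((q-1)^r-(q-2)r-1\big)$.
   Context: A $q$-ary matrix has entries in $\{0,1,\ldots,q-1\}$; a $q$-ary $m\times n$ matrix is a strong lonesum matrix if no other $q$-ary $m\times n$ matrix has the same row sums and column sums. A symmetric strong lonesum matrix is a square matrix $M=M^{T}$ that is a strong lonesum matrix. For $j\ge 1$ and $l\ge 1$, $\mathcal{S}_l^j=\{(l_0,l_1,\ldots,l_j)\in\mathbb{Z}^{j+1}: \sum_{i=0}^j l_i=l,\ l_0\ge 0,\ l_i\ge 1 \text{ for } 1\le i\le j\}$. $\binom{l}{l_0,\ldots,l_j}=\frac{l!}{l_0!\cdots l_j!}$ is the multinomial coefficient. *)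

theory Defs
  imports Main
begin

definition qary_mats :: "nat \<Rightarrow> nat \<Rightarrow> nat \<Rightarrow> (nat \<Rightarrow> nat \<Rightarrow> nat) set" where
  "qary_mats q m n = {M. (\<forall>i<m. \<forall>j<n. M i j < q) \<and> (\<forall>i j. (m \<le> i \<or> n \<le> j) \<longrightarrow> M i j = 0)}"

definition row_sum :: "(nat \<Rightarrow> nat \<Rightarrow> nat) \<Rightarrow> nat \<Rightarrow> nat \<Rightarrow> nat" where
  "row_sum M n i = (\<Sum>j<n. M i j)"

definition col_sum :: "(nat \<Rightarrow> nat \<Rightarrow> nat) \<Rightarrow> nat \<Rightarrow> nat \<Rightarrow> nat" where
  "col_sum M m j = (\<Sum>i<m. M i j)"

definition strong_lonesum :: "nat \<Rightarrow> nat \<Rightarrow> nat \<Rightarrow> (nat \<Rightarrow> nat \<Rightarrow> nat) \<Rightarrow> bool" where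
  "strong_lonesum q m n M \<longleftrightarrow> M \<in> qary_mats q m n \<and>
     (\<forall>M' \<in> qary_mats q m n.
        (\<forall>i<m. row_sum M' n i = row_sum M n i) \<and> (\<forall>j<n. col_sum M' m j = col_sum M m j)
        \<longrightarrow> M' = M)"

definition B :: "nat \<Rightarrow> nat \<Rightarrow> nat" where
  "B n q = card {M. strong_lonesum q n n M \<and> (\<forall>i j. M i j = M j i)}"

definition S_set :: "nat \<Rightarrow> nat \<Rightarrow> nat list set" where
  "S_set l j = {ls. length ls = j + 1 \<and> sum_list ls = l \<and> (\<forall>i\<in>{1..j}. 1 \<le> ls ! i)}"

definition multinomial :: "nat \<Rightarrow> nat list \<Rightarrow> nat" where
  "multinomial l ls = fact l div (\<Prod>x\<leftarrow>ls. fact x)"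

definition f_q :: "nat \<Rightarrow> nat \<Rightarrow> nat \<Rightarrow> int" where
  "f_q q r s = 1 + (int q - 2) * int r * int s
      + int r * ((int q - 1) ^ s - (int q - 2) * int s - 1)
      + int s * ((int q - 1) ^ r - (int q - 2) * int r - 1)"

end

theory Submission
  imports Defs "HOL-Library.FuncSet"
begin

text \<open>
  A matrix is strong lonesum iff it admits no switch, i.e. no 2 by 2 submatrix in which one diagonal
  can be raised and the other one lowered. In such a matrix the row supports form a chain. Remove
  the zero rows and columns of a symmetric one. Some row then has no zero entry; let \<open>X\<close> be the set of
  these rows. If not every row is in \<open>X\<close>, some rows outside \<open>X\<close> vanish off \<open>X\<close>; let \<open>W\<close> be the
  set of these. Excluding switches forces the entry \<open>q - 1\<close> in the rows \<open>X\<close> except on \<open>X \<times> W\<close>, and there the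
  entries different from \<open>q - 1\<close> lie in one row or in one column, which leaves \<open>f\<^sub>q (|X|, |W|)\<close> choices.
  What remains off \<open>X \<union> W\<close> is an arbitrary symmetric strong lonesum matrix without zero rows. If
  every row is in \<open>X\<close>, at most one entry differs from \<open>q - 1\<close>, and it is on the diagonal. The
  sum satisfies the same recursion: split off the first two parts of a composition.
\<close>

section \<open>Strong lonesum matrices have no switch\<close>

lemma sum_eq_if_two_changed:
  fixes f g :: "'a \<Rightarrow> nat"
  assumes "finite S" "a \<in> S" "b \<in> S" "a \<noteq> b" "f a + f b = g a + g b"
    and "\<And>x. x \<in> S \<Longrightarrow> x \<noteq> a \<Longrightarrow> x \<noteq> b \<Longrightarrow> f x = g x"
  shows "sum f S = sum g S"
proof -
  have split: "sum h S = h a + h b + sum h (S - {a} - {b})" for h :: "'a \<Rightarrow> nat"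
    using assms(1-4) by (simp add: sum.remove[of S a] sum.remove[of "S - {a}" b])
  have "sum f (S - {a} - {b}) = sum g (S - {a} - {b})"
    by (rule sum.cong) (auto simp: assms(6))
  then show ?thesis
    using assms(5) split[of f] split[of g] by simp
qed

lemma sum_eq_imp_less_elsewhere:
  fixes f g :: "'a \<Rightarrow> nat"
  assumes "finite S" "sum f S = sum g S" "x \<in> S" "f x < g x"
  shows "\<exists>y\<in>S. g y < f y"
proof (rule ccontr)
  assume "\<not> ?thesis"
  then have "sum f S < sum g S"
    using assms by (intro sum_strict_mono_ex1) (auto simp: not_less)
  with assms(2) show False by simp
qed

text \<open>The entries at \<open>(i, j)\<close> and \<open>(i', j')\<close> have room to grow by
  one and the other two corners room to shrink by one; doing both keeps every row and column
  sum.\<close>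

definition switch :: "nat \<Rightarrow> (nat \<Rightarrow> nat \<Rightarrow> nat) \<Rightarrow> nat \<Rightarrow> nat \<Rightarrow> nat \<Rightarrow> nat \<Rightarrow> bool" where
  "switch d M i i' j j' \<longleftrightarrow> i \<noteq> i' \<and> j \<noteq> j' \<and> M i j < d \<and> 0 < M i' j \<and> M i' j' < d \<and> 0 < M i j'"

text \<open>Carrying out the switch yields a second matrix \<open>M'\<close> with the same
  sums.\<close>

lemma strong_lonesum_no_switch:
  assumes "strong_lonesum q m n M" "i < m" "i' < m" "j < n" "j' < n"
  shows "\<not> switch (q - 1) M i i' j j'"
proof
  assume sw: "switch (q - 1) M i i' j j'"
  define M' where "M' a b =
    (if a = i \<and> b = j \<or> a = i' \<and> b = j' then M a b + 1
     else if a = i' \<and> b = j \<or> a = i \<and> b = j' then M a b - 1 else M a b)" for a b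
  have M: "M \<in> qary_mats q m n" using assms(1) by (simp add: strong_lonesum_def)
  have "M' \<in> qary_mats q m n"
    unfolding qary_mats_def
  proof (intro CollectI conjI allI impI)
    fix a b assume "a < m" "b < n"
    then have "M a b < q" using M by (simp add: qary_mats_def)
    then show "M' a b < q" using sw by (auto simp: M'_def switch_def)
  next
    fix a b assume "m \<le> a \<or> n \<le> b"
    then show "M' a b = 0" using M assms by (auto simp: M'_def qary_mats_def)
  qed
  moreover have "row_sum M' n a = row_sum M n a" for a
  proof (cases "a = i \<or> a = i'")
    case True
    then show ?thesis unfolding row_sum_def using sw assms
      by (intro sum_eq_if_two_changed[of _ j j']) (auto simp: M'_def switch_def)
  next
    case False
    then show ?thesis unfolding row_sum_def by (auto simp: M'_def intro!: sum.cong)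
  qed
  moreover have "col_sum M' m b = col_sum M m b" for b
  proof (cases "b = j \<or> b = j'")
    case True
    then show ?thesis unfolding col_sum_def using sw assms
      by (intro sum_eq_if_two_changed[of _ i i']) (auto simp: M'_def switch_def)
  next
    case False
    then show ?thesis unfolding col_sum_def by (auto simp: M'_def intro!: sum.cong)
  qed
  ultimately have "M' = M" using assms(1) by (simp add: strong_lonesum_def)
  then have "M' i j = M i j" by simp
  then show False by (simp add: M'_def)
qed

text \<open>If \<open>M'\<close> has the same sums but differs from \<open>M\<close>, then the cells
  where \<open>M'\<close> is larger and those where it is smaller alternate along an infinite path
  of column and row moves. Without switches such a path meets a new row at each step, which is
  impossible with \<open>m\<close> rows.\<close>

lemma strong_lonesum_if_no_switch:
  assumes q: "2 \<le> q" and M: "M \<in> qary_mats q m n"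
    and no: "\<And>i i' j j'. i < m \<Longrightarrow> i' < m \<Longrightarrow> j < n \<Longrightarrow> j' < n \<Longrightarrow> \<not> switch (q - 1) M i i' j j'"
  shows "strong_lonesum q m n M"
  unfolding strong_lonesum_def
proof (intro conjI ballI impI M)
  fix M' assume M': "M' \<in> qary_mats q m n"
    and "(\<forall>i<m. row_sum M' n i = row_sum M n i) \<and> (\<forall>j<n. col_sum M' m j = col_sum M m j)"
  then have rows: "\<And>i. i < m \<Longrightarrow> (\<Sum>j<n. M' i j) = (\<Sum>j<n. M i j)"
    and cols: "\<And>j. j < n \<Longrightarrow> (\<Sum>i<m. M' i j) = (\<Sum>i<m. M i j)"
    by (auto simp: row_sum_def col_sum_def)
  define P where "P = {p. fst p < m \<and> snd p < n \<and> M (fst p) (snd p) < M' (fst p) (snd p)}"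
  have incr: "\<exists>j'. (i, j') \<in> P" if "i < m" "j < n" "M' i j < M i j" for i j
    using sum_eq_imp_less_elsewhere[of "{..<n}" "M' i" "M i" j] rows that by (auto simp: P_def)
  have decr: "\<exists>i'<m. M' i' j < M i' j" if "(i, j) \<in> P" for i j
    using sum_eq_imp_less_elsewhere[of "{..<m}" "\<lambda>i. M i j" "\<lambda>i. M' i j" i] cols that
    by (auto simp: P_def)
  show "M' = M"
  proof (rule ccontr)
    assume "M' \<noteq> M"
    then obtain i j where ne: "M' i j \<noteq> M i j" by (metis ext)
    then have "i < m" "j < n" using M M' by (auto simp: qary_mats_def) (metis not_less)+
    have "\<exists>p. p \<in> P"
    proof (cases "M' i j < M i j")
      case True
      then show ?thesis using incr \<open>i < m\<close> \<open>j < n\<close> by blast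
    next
      case False
      then have "(i, j) \<in> P" using ne \<open>i < m\<close> \<open>j < n\<close> by (auto simp: P_def)
      then show ?thesis ..
    qed
    \<comment> \<open>One move of the path: within the column of \<open>p\<close> go to a cell where
      \<open>M'\<close> is smaller, then within that row to a cell of \<open>P\<close>.\<close>
    moreover have "\<exists>p'. p' \<in> P \<and> M' (fst p') (snd p) < M (fst p') (snd p)" if p: "p \<in> P" for p
    proof -
      obtain i' where "i' < m" "M' i' (snd p) < M i' (snd p)"
        using decr[of "fst p" "snd p"] p by auto
      moreover from this obtain j' where "(i', j') \<in> P"
        using incr[of i' "snd p"] p by (auto simp: P_def)
      ultimately show ?thesis by (intro exI[of _ "(i', j')"]) auto
    qed
    ultimately obtain s where s: "\<And>t. s t \<in> P"
        "\<And>t. M' (fst (s (Suc t))) (snd (s t)) < M (fst (s (Suc t))) (snd (s t))"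
      using dependent_nat_choice[of "\<lambda>_ p. p \<in> P" "\<lambda>_ p p'. M' (fst p') (snd p) < M (fst p') (snd p)"]
      by metis
    define r c where "r = fst \<circ> s" and "c = snd \<circ> s"
    have r: "r t < m" and c: "c t < n" and up: "M (r t) (c t) < M' (r t) (c t)"
      and down: "M' (r (Suc t)) (c t) < M (r (Suc t)) (c t)" for t
      using s(1)[of t] s(2)[of t] by (auto simp: r_def c_def P_def)
    have lt: "M (r t) (c t) < q - 1" for t
    proof -
      have "M' (r t) (c t) < q" using M' r[of t] c[of t] by (simp add: qary_mats_def)
      then show ?thesis using up[of t] by linarith
    qed
    have gt: "0 < M (r (Suc t)) (c t)" for t using down[of t] by simp
    have c_ne: "c t \<noteq> c (Suc t)" for t using up[of "Suc t"] down[of t] by (metis not_less_iff_gr_or_eq)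
    have r_ne: "r t \<noteq> r (Suc t)" for t using up[of t] down[of t] by (metis not_less_iff_gr_or_eq)
    \<comment> \<open>Since switches are excluded, an alternating path never returns to its first row.\<close>
    have zero: "M (r t) (c (Suc (t + k))) = 0" for t k
    proof (induction k)
      case 0
      then show ?case
        using no[OF r r c c, of t "Suc t" t "Suc t"] lt[of t] gt[of t] lt[of "Suc t"] c_ne[of t] r_ne[of t]
        by (auto simp: switch_def)
    next
      case (Suc k)
      let ?u = "Suc (t + k)"
      \<comment> \<open>By the induction hypothesis row \<open>r t\<close> is zero in column
        \<open>c ?u\<close>, where row \<open>r (Suc ?u)\<close> is positive. This zero is below
        \<open>q - 1\<close> because \<open>2 \<le> q\<close>, so it can serve as a corner to be
        raised.\<close>
      have "r t \<noteq> r (Suc ?u)" using Suc gt[of ?u] by auto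
      then show ?case
        using no[OF r r c c, of t "Suc ?u" ?u "Suc ?u"] Suc gt[of ?u] lt[of "Suc ?u"] c_ne[of ?u] q
        by (auto simp: switch_def)
    qed
    have "r t \<noteq> r (Suc (t + k))" for t k
    proof (cases k)
      case 0
      then show ?thesis using r_ne by simp
    next
      case (Suc k')
      then show ?thesis using zero[of t k'] gt[of "Suc (t + k')"] by auto
    qed
    then have "inj r" by (metis linorder_inj_onI' less_iff_Suc_add)
    moreover have "finite (range r)" using r by (auto intro: finite_subset[of _ "{..<m}"])
    ultimately show False using finite_imageD by blast
  qed
qed

text \<open>Throughout, \<open>d\<close> is the largest entry \<open>q - 1\<close>.\<close>

definition symm_lonesum :: "nat \<Rightarrow> nat set \<Rightarrow> (nat \<Rightarrow> nat \<Rightarrow> nat) set" where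
  "symm_lonesum d A = {M. (\<forall>i j. M i j \<le> d) \<and> (\<forall>i j. i \<notin> A \<or> j \<notin> A \<longrightarrow> M i j = 0) \<and> (\<forall>i j. M i j = M j i)
     \<and> (\<forall>i i' j j'. \<not> switch d M i i' j j')}"

text \<open>Having no zero row on \<open>A\<close> makes \<open>A\<close> recoverable from the
  matrix. Index sets replace sizes because peeling passes to submatrices on arbitrary
  subsets.\<close>

definition nonzero_lonesum :: "nat \<Rightarrow> nat set \<Rightarrow> (nat \<Rightarrow> nat \<Rightarrow> nat) set" where
  "nonzero_lonesum d A = {M \<in> symm_lonesum d A. \<forall>i\<in>A. \<exists>j\<in>A. 0 < M i j}"

section \<open>Counting star patterns\<close>

definition vecs :: "nat \<Rightarrow> nat set \<Rightarrow> (nat \<Rightarrow> nat) set" where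
  "vecs d W = {h. (\<forall>w. h w < d) \<and> (\<forall>w. w \<notin> W \<longrightarrow> h w = 0)}"

lemma vecs_card:
  assumes "finite W" "0 < d"
  shows "finite (vecs d W)" "card (vecs d W) = d ^ card W"
proof -
  have bij: "bij_betw (\<lambda>h. restrict h W) (vecs d W) (W \<rightarrow>\<^sub>E {..<d})"
  proof (rule bij_betw_byWitness[where f' = "\<lambda>h w. if w \<in> W then h w else 0"])
    show "\<forall>h\<in>vecs d W. (\<lambda>w. if w \<in> W then restrict h W w else 0) = h"
      by (auto simp: vecs_def)
    show "\<forall>h\<in>W \<rightarrow>\<^sub>E {..<d}. restrict (\<lambda>w. if w \<in> W then h w else 0) W = h"
      by (auto simp: PiE_def extensional_def restrict_def)
    show "(\<lambda>h. restrict h W) ` vecs d W \<subseteq> W \<rightarrow>\<^sub>E {..<d}"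
      by (auto simp: vecs_def)
    show "(\<lambda>h w. if w \<in> W then h w else 0) ` (W \<rightarrow>\<^sub>E {..<d}) \<subseteq> vecs d W"
      using assms(2) by (auto simp: vecs_def PiE_def Pi_def)
  qed
  show "card (vecs d W) = d ^ card W"
    using bij_betw_same_card[OF bij] assms(1) by (simp add: card_funcsetE)
  show "finite (vecs d W)"
    using bij_betw_finite[OF bij] assms(1) by (simp add: finite_PiE)
qed

text \<open>Deficits concentrated in one row; those in one column are the flips of
  \<open>line_mats d W X\<close>. The row \<open>x\<close> ranges over all naturals, so the zero
  pattern belongs even if \<open>X\<close> is empty.\<close>

definition line_mats :: "nat \<Rightarrow> nat set \<Rightarrow> nat set \<Rightarrow> (nat \<Rightarrow> nat \<Rightarrow> nat) set" where
  "line_mats d X W = {g. (\<forall>i j. g i j < d) \<and> (\<forall>i j. i \<notin> X \<or> j \<notin> W \<longrightarrow> g i j = 0)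
     \<and> (\<exists>x. \<forall>i j. i \<noteq> x \<longrightarrow> g i j = 0)}"

lemma line_mats_row: "g \<in> line_mats d X W \<Longrightarrow> \<exists>x. \<forall>i j. i \<noteq> x \<longrightarrow> g i j = 0"
  by (simp add: line_mats_def)

lemma line_mats_support: "g \<in> line_mats d X W \<Longrightarrow> g i j \<noteq> 0 \<Longrightarrow> i \<in> X \<and> j \<in> W"
proof -
  assume g: "g \<in> line_mats d X W" "g i j \<noteq> 0"
  then have "\<forall>i j. i \<notin> X \<or> j \<notin> W \<longrightarrow> g i j = 0" by (simp add: line_mats_def)
  from this[rule_format, of i j] show ?thesis using g(2) by auto
qed

text \<open>The deficits \<open>q - 1 - M i j\<close> on the block \<open>X \<times> W\<close>: the support is a star of the bipartite graph.\<close>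

definition star :: "nat \<Rightarrow> nat set \<Rightarrow> nat set \<Rightarrow> (nat \<Rightarrow> nat \<Rightarrow> nat) set" where
  "star d X W = {g. (\<forall>i j. g i j < d) \<and> (\<forall>i j. i \<notin> X \<or> j \<notin> W \<longrightarrow> g i j = 0)
     \<and> (\<forall>i i' j j'. i \<noteq> i' \<longrightarrow> j \<noteq> j' \<longrightarrow> g i j = 0 \<or> g i' j' = 0)}"

abbreviation (input) flip :: "(nat \<Rightarrow> nat \<Rightarrow> nat) \<Rightarrow> nat \<Rightarrow> nat \<Rightarrow> nat" where
  "flip g \<equiv> \<lambda>i j. g j i"

text \<open>A nonzero pattern determines its row \<open>x\<close> and its nonzero row vector; the
  zero pattern, which fits every row, is counted once.\<close>

lemma line_mats_card:
  assumes "finite X" "finite W" "0 < d"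
  shows "finite (line_mats d X W)" "card (line_mats d X W) = 1 + card X * (d ^ card W - 1)"
proof -
  let ?z = "\<lambda>_ _. 0 :: nat"
  define F where "F = (\<lambda>(x::nat, h) i (j::nat). if i = x then h j else (0::nat))"
  define D where "D = X \<times> (vecs d W - {\<lambda>_. 0})"
  have eq: "line_mats d X W = insert ?z (F ` D)"
  proof (intro subset_antisym subsetI)
    fix g assume g: "g \<in> line_mats d X W"
    then obtain x where x: "\<And>i j. i \<noteq> x \<Longrightarrow> g i j = 0" using line_mats_row by blast
    show "g \<in> insert ?z (F ` D)"
    proof (cases "g = ?z")
      case False
      then obtain i j where "g i j \<noteq> 0" by (metis ext)
      then have "g x j \<noteq> 0" using x by (cases "i = x") auto
      then have "x \<in> X" using line_mats_support[OF g] by blast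
      moreover have "g x \<in> vecs d W" using g by (simp add: line_mats_def vecs_def)
      ultimately have "(x, g x) \<in> D" using \<open>g x j \<noteq> 0\<close> by (auto simp: D_def)
      moreover have "g = F (x, g x)" using x by (auto simp: F_def fun_eq_iff)
      ultimately show ?thesis by blast
    qed simp
  next
    fix g assume "g \<in> insert ?z (F ` D)"
    then show "g \<in> line_mats d X W"
      using \<open>0 < d\<close> by (auto simp: line_mats_def F_def D_def vecs_def)
  qed
  have inj: "inj_on F D"
  proof (rule inj_onI, clarify)
    fix x h x' h' assume *: "(x, h) \<in> D" "(x', h') \<in> D" and e: "F (x, h) = F (x', h')"
    obtain w where w: "h w \<noteq> 0" using * by (auto simp: D_def fun_eq_iff)
    have "x = x'" using fun_cong[OF fun_cong[OF e, of x], of w] w by (auto simp: F_def split: if_splits)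
    moreover have "h w = h' w" for w
      using fun_cong[OF fun_cong[OF e, of x], of w] \<open>x = x'\<close> by (auto simp: F_def)
    ultimately show "x = x' \<and> h = h'" by auto
  qed
  have fin: "finite D" using assms vecs_card by (auto simp: D_def)
  have "?z \<notin> F ` D" by (auto simp: D_def F_def fun_eq_iff) metis
  moreover have "card D = card X * (d ^ card W - 1)"
  proof -
    have "(\<lambda>_. 0) \<in> vecs d W" using \<open>0 < d\<close> by (auto simp: vecs_def)
    then show ?thesis using assms vecs_card by (simp add: D_def card_cartesian_product)
  qed
  ultimately show "card (line_mats d X W) = 1 + card X * (d ^ card W - 1)"
    using fin by (simp add: eq card_image[OF inj])
  show "finite (line_mats d X W)" using fin by (simp add: eq)
qed

text \<open>Lying both in one row and in one column means having at most one nonzero cell, with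
  \<open>d - 1\<close> possible values.\<close>

lemma line_mats_flip_inter_card:
  assumes "finite X" "finite W" "0 < d"
  shows "card (line_mats d X W \<inter> flip ` line_mats d W X) = 1 + card X * card W * (d - 1)"
proof -
  let ?z = "\<lambda>_ _. 0 :: nat"
  define F where "F = (\<lambda>(x::nat, y::nat, v::nat) i j. if i = x \<and> j = y then v else 0)"
  define D where "D = X \<times> W \<times> {1..<d}"
  have eq: "line_mats d X W \<inter> flip ` line_mats d W X = insert ?z (F ` D)"
  proof (intro subset_antisym subsetI)
    fix g assume "g \<in> line_mats d X W \<inter> flip ` line_mats d W X"
    then obtain g' where g: "g \<in> line_mats d X W" and g': "g = flip g'" "g' \<in> line_mats d W X"
      by blast
    obtain x where x: "\<And>i j. i \<noteq> x \<Longrightarrow> g i j = 0" using line_mats_row[OF g] by blast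
    obtain y where y: "\<And>i j. j \<noteq> y \<Longrightarrow> g i j = 0" using line_mats_row[OF g'(2)] g'(1) by blast
    show "g \<in> insert ?z (F ` D)"
    proof (cases "g x y = 0")
      case True
      then have "g i j = 0" for i j using x y by (cases "i = x"; cases "j = y") auto
      then show ?thesis by (auto simp: fun_eq_iff)
    next
      case False
      then have "x \<in> X" "y \<in> W" using line_mats_support[OF g] by blast+
      moreover have "g x y < d" using g by (simp add: line_mats_def)
      ultimately have "(x, y, g x y) \<in> D" using False by (simp add: D_def)
      moreover have "g = F (x, y, g x y)" using x y by (auto simp: F_def fun_eq_iff)
      ultimately show ?thesis by blast
    qed
  next
    fix g assume g: "g \<in> insert ?z (F ` D)"
    then have "g \<in> line_mats d X W"
      using \<open>0 < d\<close> by (auto simp: line_mats_def F_def D_def)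
    moreover have "flip g \<in> line_mats d W X"
      using g \<open>0 < d\<close> by (auto simp: line_mats_def F_def D_def)
    then have "g \<in> flip ` line_mats d W X" by (rule rev_image_eqI) simp
    ultimately show "g \<in> line_mats d X W \<inter> flip ` line_mats d W X" by blast
  qed
  have inj: "inj_on F D"
  proof (rule inj_onI)
    fix p p' assume *: "p \<in> D" and e: "F p = F p'"
    obtain x y v x' y' v' where p: "p = (x, y, v)" "p' = (x', y', v')" by (metis prod_cases3)
    have "v \<noteq> 0" using * by (simp add: D_def p)
    then show "p = p'"
      using fun_cong[OF fun_cong[OF e, of x], of y] by (auto simp: F_def p split: if_splits)
  qed
  have "finite D" using assms by (auto simp: D_def)
  moreover have "?z \<notin> F ` D"
  proof
    assume "?z \<in> F ` D"
    then obtain x y v where *: "(x, y, v) \<in> D" "?z = F (x, y, v)" by auto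
    show False using *(1) fun_cong[OF fun_cong[OF *(2), of x], of y] by (simp add: D_def F_def)
  qed
  ultimately show ?thesis
    by (simp add: eq card_image[OF inj]) (simp add: D_def card_cartesian_product)
qed

lemma star_eq_lines:
  assumes "0 < d"
  shows "star d X W = line_mats d X W \<union> flip ` line_mats d W X"
proof (intro subset_antisym subsetI)
  fix g assume g: "g \<in> star d X W"
  then have st: "\<And>i i' j j'. i \<noteq> i' \<Longrightarrow> j \<noteq> j' \<Longrightarrow> g i j = 0 \<or> g i' j' = 0"
    by (auto simp: star_def)
  show "g \<in> line_mats d X W \<union> flip ` line_mats d W X"
  proof (cases "\<exists>x. \<forall>i j. i \<noteq> x \<longrightarrow> g i j = 0")
    case True
    then show ?thesis using g by (auto simp: star_def line_mats_def)
  next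
    case False
    then obtain i j where ij: "g i j \<noteq> 0" by auto
    from False obtain i' j' where i': "i' \<noteq> i" "g i' j' \<noteq> 0" by blast
    \<comment> \<open>The nonzero cells in rows \<open>i\<close> and \<open>i'\<close> must share
      column \<open>j\<close>. A nonzero cell in another column would have to lie in both
      rows.\<close>
    have "\<forall>b a. b \<noteq> j \<longrightarrow> g a b = 0" using st ij i' by metis
    then have "flip g \<in> line_mats d W X" using g by (auto simp: star_def line_mats_def)
    then have "g \<in> flip ` line_mats d W X" by (rule rev_image_eqI) simp
    then show ?thesis ..
  qed
next
  fix g assume g: "g \<in> line_mats d X W \<union> flip ` line_mats d W X"
  then consider x where "\<forall>i j. i \<noteq> x \<longrightarrow> g i j = 0" | y where "\<forall>i j. j \<noteq> y \<longrightarrow> g i j = 0"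
    using line_mats_row by blast
  then have "g i j = 0 \<or> g i' j' = 0" if "i \<noteq> i'" "j \<noteq> j'" for i i' j j'
    using that by cases (metis, metis)
  then show "g \<in> star d X W" using g by (auto simp: star_def line_mats_def)
qed

text \<open>Inclusion-exclusion over row and column patterns. In \<open>f_q\<close> the summands
  count the zero pattern, the patterns with one nonzero cell, and those with at least two nonzero
  cells in one row or in one column.\<close>

lemma star_card:
  assumes "finite X" "finite W" "0 < d"
  shows "int (card (star d X W)) = f_q (Suc d) (card X) (card W)"
proof -
  have inj: "inj_on flip S" for S by (rule inj_onI) (auto simp: fun_eq_iff)
  let ?R = "line_mats d X W" and ?C = "flip ` line_mats d W X"
  have "card ?R + card ?C = card (star d X W) + card (?R \<inter> ?C)"
    unfolding star_eq_lines[OF assms(3)]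
    by (rule card_Un_Int) (auto intro: line_mats_card assms)
  then have "int (card (star d X W)) = int (card ?R) + int (card ?C) - int (card (?R \<inter> ?C))"
    by linarith
  \<comment> \<open>Since \<open>0 < d\<close>, the truncated subtraction is exact.\<close>
  moreover have pow: "int (d ^ k - 1) = int d ^ k - 1" for k
    using assms(3) by (simp add: of_nat_diff)
  have "int (card ?R) = 1 + int (card X) * (int d ^ card W - 1)"
    using assms by (simp add: line_mats_card pow del: One_nat_def)
  moreover have "int (card ?C) = 1 + int (card W) * (int d ^ card X - 1)"
    using assms by (simp add: card_image[OF inj] line_mats_card pow del: One_nat_def)
  moreover have "int (card (?R \<inter> ?C)) = 1 + int (card X) * int (card W) * (int d - 1)"
    using assms pow[of 1] by (simp add: line_mats_flip_inter_card del: One_nat_def)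
  ultimately show ?thesis
    by (simp add: f_q_def algebra_simps)
qed

section \<open>Sums over compositions\<close>

lemma sum_subsets_by_card:
  fixes h :: "nat \<Rightarrow> int"
  assumes "finite A" "finite K"
  shows "(\<Sum>X | X \<subseteq> A \<and> card X \<in> K. h (card X)) = (\<Sum>k\<in>K. int (card A choose k) * h k)"
proof -
  let ?S = "{X. X \<subseteq> A \<and> card X \<in> K}"
  have "(\<Sum>X\<in>?S. h (card X)) = (\<Sum>k\<in>K. \<Sum>X\<in>{X\<in>?S. card X = k}. h (card X))"
    using assms by (intro sum.group[symmetric]) auto
  also have "\<dots> = (\<Sum>k\<in>K. int (card A choose k) * h k)"
  proof (rule sum.cong[OF refl])
    fix k assume "k \<in> K"
    then have "{X\<in>?S. card X = k} = {X. X \<subseteq> A \<and> card X = k}" by auto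
    then show "(\<Sum>X\<in>{X\<in>?S. card X = k}. h (card X)) = int (card A choose k) * h k"
      using n_subsets[OF assms(1), of k] by simp
  qed
  finally show ?thesis .
qed

text \<open>These lists are the tails of the members of \<open>S_set\<close>: the head, which may be
  0, is the number of zero rows, and the tail gives the sizes of the successive layers.\<close>

definition compositions :: "nat \<Rightarrow> nat list set" where
  "compositions m = {cs. sum_list cs = m \<and> 0 \<notin> set cs}"

lemma length_compositions: "cs \<in> compositions m \<Longrightarrow> length cs \<le> m"
proof (induction cs arbitrary: m)
  case (Cons a cs)
  then have "length cs \<le> sum_list cs" by (auto simp: compositions_def)
  then show ?case using Cons.prems by (auto simp: compositions_def)
qed simp

lemma finite_compositions: "finite (compositions m)"
proof (rule finite_subset)
  show "compositions m \<subseteq> {cs. set cs \<subseteq> {..m} \<and> length cs \<le> m}"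
    using length_compositions by (auto simp: compositions_def elem_le_sum_list dest: member_le_sum_list)
  show "finite {cs. set cs \<subseteq> {..m} \<and> length cs \<le> m}"
    by (rule finite_lists_length_le) simp
qed

lemma compositions_0: "compositions 0 = {[]}"
  by (auto simp: compositions_def sum_list_eq_0_iff) (metis list.set_intros(1) neq_Nil_conv)

lemma sum_compositions_head:
  fixes g :: "nat list \<Rightarrow> int"
  assumes "0 < m"
  shows "sum g (compositions m) = (\<Sum>a=1..m. \<Sum>cs\<in>compositions (m - a). g (a # cs))"
proof -
  have Cons: "\<exists>a cs. b = a # cs \<and> a \<in> {1..m} \<and> cs \<in> compositions (m - a)" if "b \<in> compositions m" for b
    using that assms by (cases b) (auto simp: compositions_def Suc_le_eq intro!: gr0I)
  have "(\<Sum>a=1..m. \<Sum>cs\<in>compositions (m - a). g (a # cs)) =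
        (\<Sum>(a, cs)\<in>(SIGMA a:{1..m}. compositions (m - a)). g (a # cs))"
    using finite_compositions by (intro sum.Sigma) auto
  also have "\<dots> = sum g (compositions m)"
    by (rule sum.reindex_bij_witness[where i = "\<lambda>cs. (hd cs, tl cs)" and j = "\<lambda>(a, cs). a # cs"])
      (auto dest!: Cons, auto simp: compositions_def)
  finally show ?thesis ..
qed

text \<open>Splitting off the head twice; the first part exhausts \<open>m\<close> only for the
  one-part composition, and this gives the separate term.\<close>

lemma sum_compositions_two:
  fixes g :: "nat list \<Rightarrow> int"
  assumes "0 < m"
  shows "sum g (compositions m) = g [m] + (\<Sum>a=1..m. \<Sum>b=1..m-a. \<Sum>cs\<in>compositions (m - a - b). g (a # b # cs))"
proof -
  have "(\<Sum>cs\<in>compositions (m - a). g (a # cs)) =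
     (if a = m then g [m] else 0) + (\<Sum>b=1..m-a. \<Sum>cs\<in>compositions (m - a - b). g (a # b # cs))"
    if "a \<in> {1..m}" for a
    using that by (cases "a = m") (auto simp: compositions_0 sum_compositions_head)
  then show ?thesis
    using assms by (simp add: sum_compositions_head sum.distrib)
qed

lemma prod_fact_dvd: "prod_list (map fact ls) dvd (fact (sum_list ls) :: nat)"
proof (induction ls)
  case (Cons a ls)
  then have "fact a * prod_list (map fact ls) dvd fact a * (fact (sum_list ls) :: nat)"
    by (rule mult_dvd_mono[OF dvd_refl])
  also have "\<dots> dvd fact (a + sum_list ls)" by (rule fact_fact_dvd_fact)
  finally show ?case by simp
qed simp

text \<open>The factor \<open>fact a\<close> cancels, and the remaining division is exact by
  \<open>prod_fact_dvd\<close>, so the binomial can be pulled out of \<open>div\<close>.\<close>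

lemma multinomial_Cons:
  assumes "sum_list ls = m - a" "a \<le> m"
  shows "multinomial m (a # ls) = (m choose a) * multinomial (m - a) ls"
proof -
  let ?P = "prod_list (map fact ls) :: nat"
  have "fact m = fact a * (fact (m - a) * (m choose a))"
    using binomial_fact_lemma[OF assms(2)] by (simp add: algebra_simps)
  then have "multinomial m (a # ls) = (fact (m - a) * (m choose a)) div ?P"
    by (simp add: multinomial_def)
  also have "\<dots> = (m choose a) * multinomial (m - a) ls"
    using prod_fact_dvd[of ls] by (simp add: multinomial_def assms(1) div_mult_swap mult.commute)
  finally show ?thesis .
qed

text \<open>Consecutive parts are the sizes of the sets \<open>X\<close> and \<open>W\<close> of one
  layer, with \<open>f_q\<close> choices. A last unpaired part is the size of a core with only
  positive entries.\<close>

fun comp_weight :: "nat \<Rightarrow> nat list \<Rightarrow> int" where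
  "comp_weight q [] = 1"
| "comp_weight q [a] = 1 + (int q - 2) * int a"
| "comp_weight q (a # b # cs) = f_q q a b * comp_weight q cs"

text \<open>This turns out to be the number of symmetric strong lonesum matrices without zero rows
  on \<open>m\<close> indices.\<close>

definition comp_count :: "nat \<Rightarrow> nat \<Rightarrow> int" where
  "comp_count q m = (\<Sum>cs\<in>compositions m. int (multinomial m cs) * comp_weight q cs)"

lemma comp_count_0: "comp_count q 0 = 1"
  by (simp add: comp_count_def compositions_0 multinomial_def)

lemma comp_count_rec:
  assumes "0 < m"
  shows "comp_count q m = 1 + (int q - 2) * int m
    + (\<Sum>a=1..m. int (m choose a) *
        (\<Sum>b=1..m-a. int (m - a choose b) * (f_q q a b * comp_count q (m - a - b))))"
proof -
  have mult: "multinomial m (a # b # cs) = (m choose a) * ((m - a choose b) * multinomial (m - a - b) cs)"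
    if "a \<in> {1..m}" "b \<in> {1..m-a}" "cs \<in> compositions (m - a - b)" for a b cs
    using that by (simp add: compositions_def multinomial_Cons del: diff_diff_left)
  have "(\<Sum>a=1..m. \<Sum>b=1..m-a. \<Sum>cs\<in>compositions (m - a - b).
          int (multinomial m (a # b # cs)) * comp_weight q (a # b # cs))
      = (\<Sum>a=1..m. int (m choose a) *
        (\<Sum>b=1..m-a. int (m - a choose b) * (f_q q a b * comp_count q (m - a - b))))"
    unfolding comp_count_def sum_distrib_left
    by (intro sum.cong refl) (simp only: mult comp_weight.simps of_nat_mult mult_ac)
  then show ?thesis
    unfolding comp_count_def[of q m] sum_compositions_two[OF assms] by (simp add: multinomial_def)
qed

text \<open>The subtracted sum leaves the last part when the length of \<open>cs\<close> is odd, and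
  0 when it is even. The head \<open>k\<close> cancels and is kept arbitrary so that in the
  induction \<open>b\<close> can take its place.\<close>

lemma comp_weight_formula:
  "comp_weight q cs = (\<Prod>i=1..length cs div 2. f_q q ((k # cs) ! (2*i - 1)) ((k # cs) ! (2*i)))
     * (1 + (int q - 2) * (int (sum_list (k # cs)) - (\<Sum>i=0..2*(length cs div 2). int ((k # cs) ! i))))"
proof (induction q cs arbitrary: k rule: comp_weight.induct)
  case (3 q a b cs)
  have shift: "prod g {1..Suc n} = g 1 * (\<Prod>i=1..n. g (Suc i))" for g :: "nat \<Rightarrow> int" and n
    by (simp add: prod.atLeast_Suc_atMost_Suc_shift prod.atLeast_Suc_atMost del: prod.cl_ivl_Suc)
  have shift2: "sum g {0..Suc (Suc n)} = g 0 + g 1 + (\<Sum>i=0..n. g (Suc (Suc i)))" for g :: "nat \<Rightarrow> int" and n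
    by (simp add: sum.atLeast0_atMost_Suc_shift del: sum.cl_ivl_Suc)
  let ?n = "length cs div 2" and ?l = "k # a # b # cs"
  have len: "length (a # b # cs) div 2 = Suc ?n" by simp
  have "(\<Prod>i=1..?n. f_q q (?l ! (2 * Suc i - 1)) (?l ! (2 * Suc i)))
      = (\<Prod>i=1..?n. f_q q ((b # cs) ! (2 * i - 1)) ((b # cs) ! (2 * i)))"
  proof (rule prod.cong[OF refl])
    fix i assume "i \<in> {1..?n}"
    \<comment> \<open>With \<open>i\<close> positive, \<open>2 * i - 1\<close> is a genuine
      predecessor and the index shift by two is exact.\<close>
    then obtain i' where "i = Suc i'" by (cases i) auto
    then show "f_q q (?l ! (2 * Suc i - 1)) (?l ! (2 * Suc i))
        = f_q q ((b # cs) ! (2 * i - 1)) ((b # cs) ! (2 * i))" by simp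
  qed
  then have "(\<Prod>i=1..Suc ?n. f_q q (?l ! (2 * i - 1)) (?l ! (2 * i)))
      = f_q q a b * (\<Prod>i=1..?n. f_q q ((b # cs) ! (2 * i - 1)) ((b # cs) ! (2 * i)))"
    unfolding shift by (simp add: numeral_2_eq_2)
  moreover have "(\<Sum>i=0..2 * Suc ?n. int (?l ! i)) = int k + int a + (\<Sum>i=0..2 * ?n. int ((b # cs) ! i))"
    using shift2[of "\<lambda>i. int (?l ! i)" "2 * ?n"] by simp
  ultimately show ?case
    unfolding len using "3"[of b] by simp
qed (auto simp: numeral_2_eq_2)

text \<open>Regrouping by the head \<open>k\<close> instead of the length \<open>j\<close>. The
  bound \<open>j \<le> n\<close> loses nothing, as a composition of \<open>n - k\<close> has at most
  \<open>n - k\<close> parts.\<close>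

lemma sum_S_set:
  fixes g :: "nat list \<Rightarrow> int"
  shows "(\<Sum>j=0..n. sum g (S_set n j)) = (\<Sum>k=0..n. \<Sum>cs\<in>compositions (n - k). g (k # cs))"
proof -
  have S: "ls \<in> S_set n j \<longleftrightarrow> (\<exists>k cs. ls = k # cs \<and> length cs = j \<and> k \<le> n \<and> cs \<in> compositions (n - k))" for ls j
  proof (cases ls)
    case (Cons k cs)
    have "(\<forall>i\<in>{1..length cs}. 1 \<le> (k # cs) ! i) \<longleftrightarrow> 0 \<notin> set cs"
      by (auto simp: in_set_conv_nth Ball_def nth_Cons' Suc_le_eq)
    then show ?thesis using Cons by (auto simp: S_set_def compositions_def)
  qed (auto simp: S_set_def)
  have fin: "finite (S_set n j)" for j
    by (rule finite_subset[of _ "(\<lambda>(k, cs). k # cs) ` (SIGMA k:{0..n}. compositions (n - k))"])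
      (auto simp: S finite_compositions image_iff)
  have "(\<Sum>j=0..n. sum g (S_set n j)) = (\<Sum>(j, ls)\<in>(SIGMA j:{0..n}. S_set n j). g ls)"
    using fin by (intro sum.Sigma) auto
  also have "\<dots> = (\<Sum>(k, cs)\<in>(SIGMA k:{0..n}. compositions (n - k)). g (k # cs))"
    by (rule sum.reindex_bij_witness[where i = "\<lambda>(k, cs). (length cs, k # cs)" and j = "\<lambda>(j, ls). (hd ls, tl ls)"])
      (auto simp: S dest: length_compositions)
  also have "\<dots> = (\<Sum>k=0..n. \<Sum>cs\<in>compositions (n - k). g (k # cs))"
    using finite_compositions by (intro sum.Sigma[symmetric]) auto
  finally show ?thesis .
qed

lemma multinomial_sum_eq_comp_count:
  "1 + (\<Sum>j=1..n. \<Sum>ls\<in>S_set n j.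
            int (multinomial n ls)
          * (\<Prod>i=1..j div 2. f_q q (ls ! (2*i - 1)) (ls ! (2*i)))
          * (1 + (int q - 2) * (int n - (\<Sum>i=0..2*(j div 2). int (ls ! i)))))
   = (\<Sum>k=0..n. int (n choose k) * comp_count q (n - k))" (is "?L = ?R")
proof -
  let ?g = "\<lambda>ls. int (multinomial n ls) * comp_weight q (tl ls)"
  have term_eq: "int (multinomial n ls) * (\<Prod>i=1..j div 2. f_q q (ls ! (2*i - 1)) (ls ! (2*i)))
          * (1 + (int q - 2) * (int n - (\<Sum>i=0..2*(j div 2). int (ls ! i)))) = ?g ls"
    if "ls \<in> S_set n j" for ls j
  proof -
    obtain k cs where "ls = k # cs" "length cs = j" "sum_list (k # cs) = n"
      using \<open>ls \<in> S_set n j\<close> by (cases ls) (auto simp: S_set_def)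
    then show ?thesis using comp_weight_formula[of q cs k] by (simp add: mult.assoc)
  qed
  have "?L = 1 + (\<Sum>j=1..n. sum ?g (S_set n j))"
    by (intro arg_cong[where f = "\<lambda>x. 1 + x"] sum.cong refl term_eq)
  \<comment> \<open>The leading 1 of the formula is the term for \<open>j = 0\<close>.\<close>
  moreover have "S_set n 0 = {[n]}" by (auto simp: S_set_def length_Suc_conv)
  ultimately have "?L = (\<Sum>j=0..n. sum ?g (S_set n j))"
    by (simp add: sum.atLeast_Suc_atMost[of 0 n] multinomial_def)
  also have "\<dots> = (\<Sum>k=0..n. \<Sum>cs\<in>compositions (n - k). ?g (k # cs))" by (rule sum_S_set)
  also have "\<dots> = (\<Sum>k=0..n. int (n choose k) * comp_count q (n - k))"
    by (intro sum.cong refl) (simp add: comp_count_def sum_distrib_left multinomial_Cons compositions_def mult_ac)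
  finally show ?thesis .
qed

section \<open>Peeling a symmetric strong lonesum matrix\<close>

lemma finite_symm_lonesum:
  assumes "finite A" shows "finite (symm_lonesum d A)"
proof (rule finite_subset)
  let ?F = "{h. (\<forall>j. (j \<in> A \<longrightarrow> h j \<in> {..d}) \<and> (j \<notin> A \<longrightarrow> h j = 0))}"
  let ?G = "{M. (\<forall>i. (i \<in> A \<longrightarrow> M i \<in> ?F) \<and> (i \<notin> A \<longrightarrow> M i = (\<lambda>_. 0)))}"
  show "symm_lonesum d A \<subseteq> ?G" by (auto simp: symm_lonesum_def)
  show "finite ?G"
    using assms by (intro finite_set_of_finite_funs) auto
qed

lemma nonzero_lonesum_subset: "nonzero_lonesum d A \<subseteq> symm_lonesum d A"
  by (auto simp: nonzero_lonesum_def)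

lemma symm_lonesumD:
  assumes "M \<in> symm_lonesum d A"
  shows "M i j \<le> d" "M i j \<noteq> 0 \<Longrightarrow> i \<in> A \<and> j \<in> A" "M i j = M j i"
    "i \<noteq> i' \<Longrightarrow> j \<noteq> j' \<Longrightarrow> M i j < d \<Longrightarrow> 0 < M i' j \<Longrightarrow> M i' j' < d \<Longrightarrow> M i j' = 0"
proof -
  have *: "(\<forall>i j. M i j \<le> d) \<and> (\<forall>i j. i \<notin> A \<or> j \<notin> A \<longrightarrow> M i j = 0) \<and> (\<forall>i j. M i j = M j i)
     \<and> (\<forall>i i' j j'. \<not> switch d M i i' j j')"
    using assms unfolding symm_lonesum_def by (rule CollectD)
  show "M i j \<le> d" by (rule *[THEN conjunct1, THEN spec, THEN spec])
  show "M i j \<noteq> 0 \<Longrightarrow> i \<in> A \<and> j \<in> A"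
    using *[THEN conjunct2, THEN conjunct1, rule_format, of i j] by auto
  show "M i j = M j i" by (rule *[THEN conjunct2, THEN conjunct2, THEN conjunct1, THEN spec, THEN spec])
  have "\<not> switch d M i i' j j'" 
    by (rule *[THEN conjunct2, THEN conjunct2, THEN conjunct2, THEN spec, THEN spec, THEN spec, THEN spec])
  then show "i \<noteq> i' \<Longrightarrow> j \<noteq> j' \<Longrightarrow> M i j < d \<Longrightarrow> 0 < M i' j \<Longrightarrow> M i' j' < d \<Longrightarrow> M i j' = 0"
    by (simp add: switch_def)
qed

text \<open>The set \<open>Z\<close> consists of the indices of nonzero rows, which by symmetry are
  also those of nonzero columns.\<close>

lemma symm_lonesum_eq_UN: "symm_lonesum d A = (\<Union>Z\<in>Pow A. nonzero_lonesum d Z)"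
proof (intro subset_antisym subsetI)
  fix M assume M: "M \<in> symm_lonesum d A"
  define Z where "Z = {i. \<exists>j. 0 < M i j}"
  have "Z \<subseteq> A" using symm_lonesumD(2)[OF M] by (auto simp: Z_def)
  have in_Z: "i \<in> Z \<and> j \<in> Z" if "0 < M i j" for i j
    using that symm_lonesumD(3)[OF M, of i j] unfolding Z_def by (metis (mono_tags) mem_Collect_eq)
  then have "\<forall>i j. i \<notin> Z \<or> j \<notin> Z \<longrightarrow> M i j = 0" by blast
  then have "M \<in> symm_lonesum d Z" using M by (simp add: symm_lonesum_def)
  moreover have "\<exists>j\<in>Z. 0 < M i j" if "i \<in> Z" for i
    using that in_Z unfolding Z_def by blast
  ultimately have "M \<in> nonzero_lonesum d Z" by (simp add: nonzero_lonesum_def)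
  then show "M \<in> (\<Union>Z\<in>Pow A. nonzero_lonesum d Z)" using \<open>Z \<subseteq> A\<close> by blast
next
  fix M assume "M \<in> (\<Union>Z\<in>Pow A. nonzero_lonesum d Z)"
  then obtain Z where Z: "Z \<subseteq> A" and M: "M \<in> symm_lonesum d Z" by (auto simp: nonzero_lonesum_def)
  have "\<forall>i j. i \<notin> A \<or> j \<notin> A \<longrightarrow> M i j = 0" using symm_lonesumD(2)[OF M] Z by blast
  then show "M \<in> symm_lonesum d A" using M by (simp add: symm_lonesum_def)
qed

lemma nonzero_lonesum_unique:
  assumes "M \<in> nonzero_lonesum d Z" "M \<in> nonzero_lonesum d Z'" shows "Z = Z'"
proof -
  have "Z \<subseteq> Z'" if "M \<in> nonzero_lonesum d Z" "M \<in> nonzero_lonesum d Z'" for Z Z'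
  proof
    fix i assume "i \<in> Z"
    then obtain j where "0 < M i j" using \<open>M \<in> nonzero_lonesum d Z\<close> by (auto simp: nonzero_lonesum_def)
    then show "i \<in> Z'" using symm_lonesumD(2)[of M d Z' i j] \<open>M \<in> nonzero_lonesum d Z'\<close> by (simp add: nonzero_lonesum_def)
  qed
  then show ?thesis using assms by blast
qed

lemma card_symm_lonesum:
  assumes "finite A" shows "card (symm_lonesum d A) = (\<Sum>Z\<in>Pow A. card (nonzero_lonesum d Z))"
  unfolding symm_lonesum_eq_UN
proof (rule card_UN_disjoint)
  show "\<forall>Z\<in>Pow A. finite (nonzero_lonesum d Z)"
    using assms by (auto intro: finite_subset[OF nonzero_lonesum_subset] finite_symm_lonesum finite_subset)
  show "\<forall>Z\<in>Pow A. \<forall>Z'\<in>Pow A. Z \<noteq> Z' \<longrightarrow> nonzero_lonesum d Z \<inter> nonzero_lonesum d Z' = {}"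
    using nonzero_lonesum_unique by blast
qed (use assms in simp)

section \<open>Full rows and the rows vanishing off them\<close>

definition full_rows :: "nat set \<Rightarrow> (nat \<Rightarrow> nat \<Rightarrow> nat) \<Rightarrow> nat set" where
  "full_rows A M = {i\<in>A. \<forall>j\<in>A. 0 < M i j}"

definition zero_rows :: "nat set \<Rightarrow> (nat \<Rightarrow> nat \<Rightarrow> nat) \<Rightarrow> nat set" where
  "zero_rows A M = {i\<in>A. \<forall>j\<in>A. M i j = 0}"

definition layer :: "nat \<Rightarrow> nat set \<Rightarrow> nat set \<Rightarrow> nat set \<Rightarrow> (nat \<Rightarrow> nat \<Rightarrow> nat) set" where
  "layer d A X W = {M \<in> nonzero_lonesum d A. full_rows A M = X \<and> zero_rows (A - X) M = W}"

text \<open>Incomparable supports give two zeros and two positive entries in the pattern of a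
  switch.\<close>

lemma supports_chain:
  assumes M: "M \<in> symm_lonesum d A" "0 < d"
  shows "{j. 0 < M i j} \<subseteq> {j. 0 < M i' j} \<or> {j. 0 < M i' j} \<subseteq> {j. 0 < M i j}"
proof (rule ccontr)
  assume "\<not> ?thesis"
  then obtain j j' where "0 < M i j" "M i' j = 0" "0 < M i' j'" "M i j' = 0" by auto
  moreover from this have "i \<noteq> i'" "j' \<noteq> j" by auto
  ultimately show False using symm_lonesumD(4)[OF M(1), of i i' j' j] \<open>0 < d\<close> by simp
qed

lemma exists_extremal_support:
  assumes M: "M \<in> symm_lonesum d A" "0 < d" and S: "finite S" "S \<noteq> {}"
  shows "\<exists>i\<in>S. \<forall>i'\<in>S. {j. 0 < M i' j} \<subseteq> {j. 0 < M i j}"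
    and "\<exists>i\<in>S. \<forall>i'\<in>S. {j. 0 < M i j} \<subseteq> {j. 0 < M i' j}"
proof -
  define s where "s i = {j. 0 < M i j}" for i
  have chain: "s i \<subseteq> s i' \<or> s i' \<subseteq> s i" for i i'
    unfolding s_def by (rule supports_chain[OF M])
  obtain i where i: "i \<in> S" "\<And>i'. i' \<in> S \<Longrightarrow> s i \<subseteq> s i' \<Longrightarrow> s i = s i'"
    using finite_has_maximal[of "s ` S"] S by auto
  have "s i' \<subseteq> s i" if "i' \<in> S" for i'
    using chain[of i i'] i(2)[OF that] by auto
  then show "\<exists>i\<in>S. \<forall>i'\<in>S. {j. 0 < M i' j} \<subseteq> {j. 0 < M i j}"
    using i(1) unfolding s_def by (intro bexI ballI)
  obtain i where i: "i \<in> S" "\<And>i'. i' \<in> S \<Longrightarrow> s i' \<subseteq> s i \<Longrightarrow> s i = s i'"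
    using finite_has_minimal[of "s ` S"] S by auto
  have "s i \<subseteq> s i'" if "i' \<in> S" for i'
    using chain[of i i'] i(2)[OF that] by auto
  then show "\<exists>i\<in>S. \<forall>i'\<in>S. {j. 0 < M i j} \<subseteq> {j. 0 < M i' j}"
    using i(1) unfolding s_def by (intro bexI ballI)
qed

text \<open>A row of largest support is full: by symmetry no column is zero, so each column is met
  by some row and hence by the largest one.\<close>

lemma full_rows_nonempty:
  assumes "M \<in> nonzero_lonesum d A" "0 < d" "finite A" "A \<noteq> {}"
  shows "full_rows A M \<noteq> {}"
proof -
  have M: "M \<in> symm_lonesum d A" using assms by (simp add: nonzero_lonesum_def)
  obtain i where i: "i \<in> A" "\<And>i'. i' \<in> A \<Longrightarrow> {j. 0 < M i' j} \<subseteq> {j. 0 < M i j}"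
    using exists_extremal_support(1)[OF M assms(2-4)] by blast
  have "0 < M i j" if j: "j \<in> A" for j
  proof -
    obtain i' where "i' \<in> A" "0 < M j i'" using assms(1) j by (auto simp: nonzero_lonesum_def)
    then show ?thesis using i(2)[of i'] symm_lonesumD(3)[OF M, of j i'] by auto
  qed
  then show ?thesis using i(1) by (auto simp: full_rows_def)
qed

text \<open>Take a row \<open>i\<close> of smallest support among the rows that are not full. Each
  such \<open>j\<close> has a zero at some \<open>i'\<close>; by symmetry \<open>i'\<close> is not
  full either and vanishes at \<open>j\<close>, hence so does \<open>i\<close>.\<close>

lemma zero_rows_nonempty:
  assumes "M \<in> nonzero_lonesum d A" "0 < d" "finite A" "A - full_rows A M \<noteq> {}"
  shows "zero_rows (A - full_rows A M) M \<noteq> {}"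
proof -
  have M: "M \<in> symm_lonesum d A" using assms by (simp add: nonzero_lonesum_def)
  let ?Y = "A - full_rows A M"
  obtain i where i: "i \<in> ?Y" "\<And>i'. i' \<in> ?Y \<Longrightarrow> {j. 0 < M i j} \<subseteq> {j. 0 < M i' j}"
    using exists_extremal_support(2)[OF M assms(2) _ assms(4)] assms(3) by blast
  have "M i j = 0" if j: "j \<in> ?Y" for j
  proof -
    obtain i' where i': "i' \<in> A" "M j i' = 0" using j by (auto simp: full_rows_def)
    then have "i' \<in> ?Y" using symm_lonesumD(3)[OF M, of j i'] j by (auto simp: full_rows_def)
    then show ?thesis using i(2)[of i'] symm_lonesumD(3)[OF M, of j i'] i' by auto
  qed
  then show ?thesis using i(1) by (auto simp: zero_rows_def)
qed

text \<open>When all entries are positive, two entries below \<open>d\<close> in different rows and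
  columns form a switch. Comparing an entry with its mirror image puts it on the diagonal, and then
  it is the only one.\<close>

lemma card_all_positive:
  assumes "finite A" "A \<noteq> {}" "0 < d"
  shows "card {M \<in> nonzero_lonesum d A. full_rows A M = A} = 1 + card A * (d - 1)"
proof -
  define c where "c i j = (if i \<in> A \<and> j \<in> A then d else 0)" for i j
  define F where "F = (\<lambda>(x, v::nat) i j. if i = x \<and> j = x then v else c i j)"
  \<comment> \<open>The value 0 is excluded by positivity, and the value \<open>d\<close> would give
    the constant matrix \<open>c\<close>, which is counted separately.\<close>
  define D where "D = A \<times> {1..<d}"
  have eq: "{M \<in> nonzero_lonesum d A. full_rows A M = A} = insert c (F ` D)"
  proof (intro subset_antisym subsetI)
    fix M assume "M \<in> {M \<in> nonzero_lonesum d A. full_rows A M = A}"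
    then have M: "M \<in> symm_lonesum d A" and pos: "\<And>i j. i \<in> A \<Longrightarrow> j \<in> A \<Longrightarrow> 0 < M i j"
      by (auto simp: nonzero_lonesum_def full_rows_def)
    have zero: "M i j = 0" if "\<not> (i \<in> A \<and> j \<in> A)" for i j using symm_lonesumD(2)[OF M] that by blast
    have share: "i = i' \<or> j = j'" if "M i j < d" "M i' j' < d" "i \<in> A" "j \<in> A" "i' \<in> A" "j' \<in> A" for i i' j j'
      using symm_lonesumD(4)[OF M, of i i' j j'] that pos[of i' j] pos[of i j'] by auto
    show "M \<in> insert c (F ` D)"
    proof (cases "\<exists>x\<in>A. \<exists>y\<in>A. M x y < d")
      case True
      then obtain x y where xy: "x \<in> A" "y \<in> A" "M x y < d" by blast
      then have x: "x = y" using share[of x y y x] symm_lonesumD(3)[OF M, of x y] by auto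
      have "M i j = d" if "i \<in> A" "j \<in> A" "\<not> (i = x \<and> j = x)" for i j
      proof (rule ccontr)
        assume "M i j \<noteq> d"
        then have lt: "M i j < d" using symm_lonesumD(1)[OF M, of i j] by simp
        then have "i = j" using share[of i j j i] symm_lonesumD(3)[OF M, of i j] that by auto
        then show False using share[of i j x y] lt xy x that by auto
      qed
      then have "M = F (x, M x x)"
        using zero by (auto simp: F_def c_def fun_eq_iff)
      moreover have "(x, M x x) \<in> D" using xy x pos[of x x] by (auto simp: D_def)
      ultimately show ?thesis by blast
    next
      case False
      have "M i j = c i j" for i j
      proof (cases "i \<in> A \<and> j \<in> A")
        case True
        then show ?thesis using False symm_lonesumD(1)[OF M, of i j] by (auto simp: c_def) (metis le_neq_implies_less)
      qed (auto simp: c_def zero)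
      then have "M = c" by (simp add: fun_eq_iff)
      then show ?thesis by blast
    qed
  next
    fix M assume M: "M \<in> insert c (F ` D)"
    have in_A: "i \<in> A \<and> j \<in> A" if "0 < M i j" for i j
      using M that by (auto simp: F_def D_def c_def split: if_splits)
    from M have "(\<forall>i j. M i j \<le> d) \<and> (\<forall>i j. i \<notin> A \<or> j \<notin> A \<longrightarrow> M i j = 0) \<and> (\<forall>i j. M i j = M j i)
        \<and> (\<forall>i\<in>A. \<forall>j\<in>A. 0 < M i j)"
      using \<open>0 < d\<close> by (auto simp: F_def D_def c_def)
    moreover have "\<exists>x. \<forall>i\<in>A. \<forall>j\<in>A. M i j < d \<longrightarrow> i = x \<and> j = x"
    proof (cases "M = c")
      case False
      then obtain x v where "M = F (x, v)" using M by auto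
      then show ?thesis by (intro exI[of _ x]) (auto simp: F_def c_def split: if_splits)
    qed (simp add: c_def)
    then obtain x where x: "\<And>i j. i \<in> A \<Longrightarrow> j \<in> A \<Longrightarrow> M i j < d \<Longrightarrow> i = x \<and> j = x" by blast
    moreover have "\<not> switch d M i i' j j'" for i i' j j'
    proof
      assume sw: "switch d M i i' j j'"
      then have "i \<in> A" "i' \<in> A" "j \<in> A" "j' \<in> A"
        using in_A[of i' j] in_A[of i j'] by (auto simp: switch_def)
      then show False using x[of i j] x[of i' j'] sw by (auto simp: switch_def)
    qed
    ultimately have "M \<in> symm_lonesum d A" "\<forall>i\<in>A. \<forall>j\<in>A. 0 < M i j" by (simp_all add: symm_lonesum_def)
    then show "M \<in> {M \<in> nonzero_lonesum d A. full_rows A M = A}"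
      using \<open>A \<noteq> {}\<close> by (auto simp: nonzero_lonesum_def full_rows_def)
  qed
  have inj: "inj_on F D"
  proof (rule inj_onI, clarify)
    fix x v x' v' assume "(x, v) \<in> D" "(x', v') \<in> D" and e: "F (x, v) = F (x', v')"
    then have "v < d" "x \<in> A" by (auto simp: D_def)
    then show "x = x' \<and> v = v'"
      using fun_cong[OF fun_cong[OF e, of x], of x] by (auto simp: F_def c_def split: if_splits)
  qed
  have "finite D" using assms by (auto simp: D_def)
  moreover have "c \<notin> F ` D"
  proof
    assume "c \<in> F ` D"
    then obtain x v where "(x, v) \<in> D" "c x x = F (x, v) x x" by auto
    then show False by (auto simp: D_def F_def c_def)
  qed
  ultimately show ?thesis
    by (simp add: eq card_image[OF inj]) (simp add: D_def card_cartesian_product)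
qed

section \<open>Decomposing a layer into a star and a smaller matrix\<close>

text \<open>The pattern \<open>g\<close> is stored as deficits on \<open>X \<times> W\<close> and is
  mirrored on \<open>W \<times> X\<close>. The rows \<open>W\<close> vanish off \<open>X\<close>
  because \<open>K\<close> vanishes off \<open>Z\<close>.\<close>

definition glue :: "nat \<Rightarrow> nat set \<Rightarrow> nat set \<Rightarrow> nat set \<Rightarrow> (nat \<Rightarrow> nat \<Rightarrow> nat) \<Rightarrow> (nat \<Rightarrow> nat \<Rightarrow> nat) \<Rightarrow> nat \<Rightarrow> nat \<Rightarrow> nat" where
  "glue d A X W g K i j =
    (if i \<notin> A \<or> j \<notin> A then 0
     else if i \<in> X then (if j \<in> W then d - g i j else d)
     else if j \<in> X then (if i \<in> W then d - g j i else d)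
     else K i j)"

locale peeling =
  fixes d :: nat and A X W Z :: "nat set"
  assumes d: "0 < d" and XA: "X \<subseteq> A" and WA: "W \<subseteq> A - X" and X: "X \<noteq> {}" and W: "W \<noteq> {}"
    and Z: "Z = A - X - W"
begin

text \<open>For the last claim, an entry below \<open>d\<close> at \<open>(i, j)\<close> forms a
  switch with a column \<open>w\<close> of \<open>W\<close> and any row that is positive at
  \<open>j\<close> and zero at \<open>w\<close>; such a row always exists.\<close>

lemma layerD:
  assumes M: "M \<in> layer d A X W"
  shows "i \<in> X \<Longrightarrow> j \<in> A \<Longrightarrow> 0 < M i j"
    and "i \<in> W \<Longrightarrow> j \<notin> X \<Longrightarrow> M i j = 0"
    and "i \<in> Z \<Longrightarrow> \<exists>j\<in>Z. 0 < M i j"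
    and "i \<in> X \<Longrightarrow> j \<in> A \<Longrightarrow> j \<notin> W \<Longrightarrow> M i j = d"
proof -
  have nz: "M \<in> nonzero_lonesum d A" and full: "full_rows A M = X" and zr: "zero_rows (A - X) M = W"
    using M by (auto simp: layer_def)
  then have sl: "M \<in> symm_lonesum d A" by (simp add: nonzero_lonesum_def)
  show pos: "0 < M i j" if "i \<in> X" "j \<in> A" for i j
    using that full by (auto simp: full_rows_def)
  show zero: "M i j = 0" if "i \<in> W" "j \<notin> X" for i j
  proof (cases "j \<in> A")
    case True
    then show ?thesis using that zr by (auto simp: zero_rows_def)
  next
    case False
    then show ?thesis using symm_lonesumD(2)[OF sl] by blast
  qed
  show row: "\<exists>j\<in>Z. 0 < M i j" if "i \<in> Z" for i
  proof -
    have "i \<in> A - X" "i \<notin> zero_rows (A - X) M" using that zr Z by auto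
    then obtain j where j: "j \<in> A - X" "0 < M i j" by (auto simp: zero_rows_def)
    then have "j \<notin> W" using zero[of j i] symm_lonesumD(3)[OF sl, of i j] \<open>i \<in> A - X\<close> by auto
    then show ?thesis using j Z by auto
  qed
  show "M i j = d" if "i \<in> X" "j \<in> A" "j \<notin> W" for i j
  proof (rule ccontr)
    assume "M i j \<noteq> d"
    then have lt: "M i j < d" using symm_lonesumD(1)[OF sl, of i j] by simp
    obtain w where w: "w \<in> W" using W by blast
    then have w': "w \<in> A" "w \<notin> X" using WA by auto
    have "\<exists>i'. i' \<noteq> i \<and> 0 < M i' j \<and> M i' w = 0"
    \<comment> \<open>For \<open>j\<close> in \<open>X\<close> the row \<open>w\<close> itself
      serves; for \<open>j\<close> in \<open>Z\<close> a row \<open>z\<close> of \<open>Z\<close>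
      that meets column \<open>j\<close>.\<close>
    proof (cases "j \<in> X")
      case True
      have "0 < M w j" using pos[OF True w'(1)] symm_lonesumD(3)[OF sl, of j w] by simp
      then show ?thesis using w w' that zero[of w w] by (intro exI[of _ w]) auto
    next
      case False
      then have "j \<in> Z" using that Z by blast
      then obtain z where z: "z \<in> Z" "0 < M j z" using row by blast
      then have "z \<notin> X" "0 < M z j" using Z symm_lonesumD(3)[OF sl, of j z] by auto
      moreover have "M z w = 0" using zero[OF w \<open>z \<notin> X\<close>] symm_lonesumD(3)[OF sl, of w z] by simp
      ultimately show ?thesis using that by (intro exI[of _ z]) auto
    qed
    then obtain i' where "i' \<noteq> i" "0 < M i' j" "M i' w = 0" by blast
    then show False
      using symm_lonesumD(4)[OF sl, of i i' j w] lt pos[OF that(1) w'(1)] w that d by auto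
  qed
qed

lemma glue_cells:
  assumes g: "g \<in> star d X W" and K: "K \<in> symm_lonesum d Z"
  shows "0 < glue d A X W g K i j \<Longrightarrow> i \<in> X \<and> j \<in> A \<or> j \<in> X \<and> i \<in> A \<or> i \<in> Z \<and> j \<in> Z \<and> 0 < K i j"
    and "glue d A X W g K i j < d \<Longrightarrow> i \<in> A \<Longrightarrow> j \<in> A \<Longrightarrow> i \<in> X \<and> j \<in> W \<and> g i j \<noteq> 0
       \<or> j \<in> X \<and> i \<in> W \<and> g j i \<noteq> 0 \<or> i \<notin> X \<and> j \<notin> X \<and> K i j < d"
  using symm_lonesumD(2)[OF K, of i j] by (auto simp: glue_def split: if_splits)

text \<open>If a switch raises a cell of \<open>X \<times> W\<close> or of its mirror image, the
  other raised cell lies in the same block, against the star condition. Otherwise all four indices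
  avoid \<open>X\<close>, and the switch would already occur in \<open>K\<close>.\<close>

lemma glue_layer:
  assumes g: "g \<in> star d X W" and K: "K \<in> nonzero_lonesum d Z"
  shows "glue d A X W g K \<in> layer d A X W"
proof -
  let ?M = "glue d A X W g K"
  have Ksl: "K \<in> symm_lonesum d Z" using K by (simp add: nonzero_lonesum_def)
  have gd: "g i j < d" for i j using g by (simp add: star_def)
  have Kzero: "K i j = 0" if "i \<notin> Z \<or> j \<notin> Z" for i j using symm_lonesumD(2)[OF Ksl, of i j] that by blast
  have sym: "?M i j = ?M j i" for i j
    using symm_lonesumD(3)[OF Ksl, of i j] XA WA by (auto simp: glue_def)
  have st: "g i j = 0 \<or> g i' j' = 0" if "i \<noteq> i'" "j \<noteq> j'" for i i' j j'
    using g that unfolding star_def mem_Collect_eq by metis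
  have no: "\<not> switch d ?M i i' j j'" for i i' j j'
  proof
    assume "switch d ?M i i' j j'"
    then have ne: "i \<noteq> i'" "j \<noteq> j'" and lt: "?M i j < d" "?M i' j' < d" and gt: "0 < ?M i' j" "0 < ?M i j'"
      by (auto simp: switch_def)
    note P = glue_cells(1)[OF g Ksl gt(1)] glue_cells(1)[OF g Ksl gt(2)]
    then have in_A: "i \<in> A" "j \<in> A" "i' \<in> A" "j' \<in> A" using XA Z by auto
    note Q = glue_cells(2)[OF g Ksl lt(1) in_A(1,2)] glue_cells(2)[OF g Ksl lt(2) in_A(3,4)]
    have disj: "\<And>x. x \<in> W \<Longrightarrow> x \<notin> X" "\<And>x. x \<in> Z \<Longrightarrow> x \<notin> X \<and> x \<notin> W" using WA Z by auto
    from Q(1) consider "i \<in> X" "j \<in> W" "g i j \<noteq> 0" | "j \<in> X" "i \<in> W" "g j i \<noteq> 0"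
      | "i \<notin> X" "j \<notin> X" "K i j < d" by blast
    then show False
    proof cases
      case 1
      then have "i' \<in> X" using P(1) disj by blast
      then have "j' \<in> W" "g i' j' \<noteq> 0" using Q(2) disj by blast+
      then show ?thesis using st[OF ne] 1 by auto
    next
      case 2
      then have "j' \<in> X" using P(2) disj by blast
      then have "i' \<in> W" "g j' i' \<noteq> 0" using Q(2) disj by blast+
      then show ?thesis using st[OF ne(2,1)] 2 by auto
    next
      case 3
      have "j' \<notin> X"
      proof
        assume "j' \<in> X"
        then have "i' \<in> W" using Q(2) disj by blast
        then show False using P(1) 3 disj by blast
      qed
      then have "0 < K i j'" using P(2) 3 by blast
      moreover have "i' \<notin> X"
      proof
        assume "i' \<in> X"
        then have "j' \<in> W" using Q(2) \<open>j' \<notin> X\<close> by blast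
        then show False using P(2) 3 \<open>j' \<notin> X\<close> disj by blast
      qed
      then have "0 < K i' j" using P(1) 3 by blast
      moreover have "K i' j' < d" using Q(2) \<open>j' \<notin> X\<close> \<open>i' \<notin> X\<close> by blast
      ultimately show ?thesis using symm_lonesumD(4)[OF Ksl ne 3(3)] by auto
    qed
  qed
  have le: "?M i j \<le> d" for i j using symm_lonesumD(1)[OF Ksl, of i j] by (simp add: glue_def)
  have zero: "?M i j = 0" if "i \<notin> A \<or> j \<notin> A" for i j using that by (auto simp: glue_def)
  have sl: "?M \<in> symm_lonesum d A"
    unfolding symm_lonesum_def mem_Collect_eq by (intro conjI allI impI le zero sym no)
  have Xpos: "0 < ?M i j" if "i \<in> X" "j \<in> A" for i j
    using that XA gd[of i j] d by (auto simp: glue_def)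
  have Wzero: "?M i j = 0" if "i \<in> W" "j \<notin> X" for i j
    using that WA Kzero[of i j] Z by (auto simp: glue_def)
  have Zrow: "\<exists>j\<in>Z. 0 < ?M i j" if i: "i \<in> Z" for i
  proof -
    obtain j where "j \<in> Z" "0 < K i j" using K i by (auto simp: nonzero_lonesum_def)
    moreover from this have "?M i j = K i j" using i Z by (simp add: glue_def)
    ultimately show ?thesis by (intro bexI[of _ j]) simp_all
  qed
  have ZA: "Z \<subseteq> A" using Z by blast
  obtain x where x: "x \<in> X" using X by blast
  have "\<exists>j\<in>A. 0 < ?M i j" if "i \<in> A" for i
  proof (cases "i \<in> Z")
    case True
    then show ?thesis using Zrow ZA by blast
  next
    case False
    have "0 < ?M i x" using Xpos[OF x that] sym[of x i] by simp
    then show ?thesis using x XA by blast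
  qed
  then have nz: "?M \<in> nonzero_lonesum d A" using sl by (simp add: nonzero_lonesum_def)
  \<comment> \<open>Every row outside \<open>X\<close> vanishes in column \<open>w\<close>, so no
    such row is full.\<close>
  obtain w where w: "w \<in> W" using W by blast
  have "i \<in> X" if "i \<in> A" "\<forall>j\<in>A. 0 < ?M i j" for i
  proof (rule ccontr)
    assume "i \<notin> X"
    then have "?M i w = 0" using Wzero[OF w, of i] sym[of i w] by simp
    moreover have "w \<in> A" using w WA by blast
    ultimately show False using bspec[OF that(2), of w] by simp
  qed
  then have full: "full_rows A ?M = X" using Xpos XA by (auto simp: full_rows_def)
  have "i \<in> W" if "i \<in> A - X" "\<forall>j\<in>A - X. ?M i j = 0" for i
  proof (rule ccontr)
    assume "i \<notin> W"
    then have "i \<in> Z" using that Z by blast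
    then obtain j where "j \<in> Z" "0 < ?M i j" using Zrow by blast
    moreover from this have "j \<in> A - X" using Z by blast
    ultimately show False using bspec[OF that(2), of j] by simp
  qed
  then have "zero_rows (A - X) ?M = W" using Wzero WA by (auto simp: zero_rows_def)
  then show ?thesis using nz full by (simp add: layer_def)
qed

lemma layer_split:
  assumes M: "M \<in> layer d A X W"
  shows "(\<lambda>i j. if i \<in> X \<and> j \<in> W then d - M i j else 0) \<in> star d X W" (is "?g \<in> _")
    and "(\<lambda>i j. if i \<in> Z \<and> j \<in> Z then M i j else 0) \<in> nonzero_lonesum d Z" (is "?K \<in> _")
proof -
  have sl: "M \<in> symm_lonesum d A" using M by (simp add: layer_def nonzero_lonesum_def)
  have XW: "0 < M i j" if "i \<in> X" "j \<in> W" for i j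
    using layerD(1)[OF M that(1), of j] that(2) WA by blast
  have "?g i j < d" for i j using XW[of i j] d by auto
  moreover have "?g i j = 0 \<or> ?g i' j' = 0" if "i \<noteq> i'" "j \<noteq> j'" for i i' j j'
  proof (rule ccontr)
    assume "\<not> ?thesis"
    then have "i \<in> X" "j \<in> W" "i' \<in> X" "j' \<in> W" "M i j < d" "M i' j' < d"
      by (auto split: if_splits)
    then show False using symm_lonesumD(4)[OF sl that] XW[of i' j] XW[of i j'] by simp
  qed
  ultimately show "?g \<in> star d X W" by (simp add: star_def)
  have "\<not> switch d ?K i i' j j'" for i i' j j'
  proof
    assume sw: "switch d ?K i i' j j'"
    then have "i \<in> Z" "i' \<in> Z" "j \<in> Z" "j' \<in> Z" by (auto simp: switch_def split: if_splits)
    then show False using symm_lonesumD(4)[OF sl, of i i' j j'] sw by (simp add: switch_def)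
  qed
  moreover have "?K i j \<le> d" "?K i j = ?K j i" for i j
    using symm_lonesumD(1)[OF sl, of i j] symm_lonesumD(3)[OF sl, of i j] by auto
  ultimately have "?K \<in> symm_lonesum d Z"
    unfolding symm_lonesum_def mem_Collect_eq by (intro conjI allI impI) auto
  then show "?K \<in> nonzero_lonesum d Z" using layerD(3)[OF M] by (auto simp: nonzero_lonesum_def)
qed

text \<open>Outside \<open>X \<times> W\<close>, its mirror image and \<open>Z \<times> Z\<close>,
  all entries of a layer matrix are forced to be 0 or \<open>d\<close>; restriction therefore
  inverts \<open>glue\<close>.\<close>

lemma card_layer: "card (layer d A X W) = card (star d X W) * card (nonzero_lonesum d Z)"
proof -
  let ?split = "\<lambda>M. (\<lambda>i j. if i \<in> X \<and> j \<in> W then d - M i j else 0,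
                    \<lambda>i j. if i \<in> Z \<and> j \<in> Z then M i j else (0::nat))"
  have "bij_betw (\<lambda>(g, K). glue d A X W g K) (star d X W \<times> nonzero_lonesum d Z) (layer d A X W)"
  proof (rule bij_betw_byWitness[where f' = ?split])
    show "(\<lambda>(g, K). glue d A X W g K) ` (star d X W \<times> nonzero_lonesum d Z) \<subseteq> layer d A X W"
      using glue_layer by auto
    show "?split ` layer d A X W \<subseteq> star d X W \<times> nonzero_lonesum d Z"
      using layer_split by auto
    have "?split (glue d A X W g K) = (g, K)" if g: "g \<in> star d X W" and K: "K \<in> nonzero_lonesum d Z" for g K
    proof -
      have sl: "K \<in> symm_lonesum d Z" using K by (simp add: nonzero_lonesum_def)
      have "(if i \<in> X \<and> j \<in> W then d - glue d A X W g K i j else 0) = g i j" for i j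
      proof (cases "i \<in> X \<and> j \<in> W")
        case True
        then have "i \<in> A" "j \<in> A" using XA WA by auto
        \<comment> \<open>This makes taking the deficit twice the identity despite truncated
          subtraction.\<close>
        moreover have "g i j \<le> d" using g by (simp add: star_def less_imp_le)
        ultimately show ?thesis using True by (simp add: glue_def)
      next
        case False
        then show ?thesis using g by (auto simp: star_def)
      qed
      moreover have "(if i \<in> Z \<and> j \<in> Z then glue d A X W g K i j else 0) = K i j" for i j
        using symm_lonesumD(2)[OF sl, of i j] Z by (auto simp: glue_def)
      ultimately show ?thesis by simp
    qed
    then show "\<forall>p\<in>star d X W \<times> nonzero_lonesum d Z. ?split (case p of (g, K) \<Rightarrow> glue d A X W g K) = p"
      by auto
    have "glue d A X W (fst (?split M)) (snd (?split M)) i j = M i j" if M: "M \<in> layer d A X W" for M i j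
    proof -
      have sl: "M \<in> symm_lonesum d A" using M by (simp add: layer_def nonzero_lonesum_def)
      note D = layerD[OF M] and le = symm_lonesumD(1)[OF sl] and sym = symm_lonesumD(3)[OF sl, of i j]
      consider "i \<notin> A \<or> j \<notin> A" | "i \<in> X" "j \<in> W" | "i \<in> X" "j \<in> A" "j \<notin> W"
        | "i \<in> W" "j \<in> X" | "i \<in> A" "i \<notin> X" "i \<notin> W" "j \<in> X"
        | "i \<in> W" "j \<in> A" "j \<notin> X" | "i \<in> A" "i \<notin> X" "i \<notin> W" "j \<in> W" | "i \<in> Z" "j \<in> Z"
        using Z by blast
      then show ?thesis
      proof cases
        case 1
        then show ?thesis using symm_lonesumD(2)[OF sl, of i j] by (auto simp: glue_def)
      next
        case 2
        then have "i \<in> A" "j \<in> A" using XA WA by auto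
        then show ?thesis using 2 le[of i j] by (simp add: glue_def)
      next
        case 3
        then show ?thesis using D(4)[of i j] XA by (auto simp: glue_def)
      next
        case 4
        then have "i \<in> A" "j \<in> A" "i \<notin> X" using XA WA by auto
        then show ?thesis using 4 le[of j i] sym by (simp add: glue_def)
      next
        case 5
        then show ?thesis using D(4)[of j i] XA sym by (auto simp: glue_def)
      next
        case 6
        then have "i \<notin> X" "i \<notin> Z" using WA Z by auto
        then show ?thesis using 6 D(2)[of i j] by (simp add: glue_def)
      next
        case 7
        then have "j \<notin> X" "j \<notin> Z" using WA Z by auto
        then show ?thesis using 7 D(2)[of j i] sym by (simp add: glue_def)
      next
        case 8
        then show ?thesis using Z by (simp add: glue_def)
      qed
    qed
    then show "\<forall>M\<in>layer d A X W. (case ?split M of (g, K) \<Rightarrow> glue d A X W g K) = M"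
      by (simp add: fun_eq_iff)
  qed
  from bij_betw_same_card[OF this] show ?thesis by (simp add: card_cartesian_product)
qed

end

section \<open>The common recursion for matrices and compositions\<close>

lemma card_nonzero_lonesum:
  assumes "finite A" "A \<noteq> {}" "0 < d"
  shows "card (nonzero_lonesum d A) = 1 + card A * (d - 1)
    + (\<Sum>X\<in>Pow A - {{}}. \<Sum>W\<in>Pow (A - X) - {{}}. card (star d X W) * card (nonzero_lonesum d (A - X - W)))"
proof -
  define I where "I = (SIGMA X:Pow A - {{}}. Pow (A - X) - {{}})"
  have finI: "finite I" using assms(1) by (auto simp: I_def)
  let ?P = "{M \<in> nonzero_lonesum d A. full_rows A M = A}"
  have fin: "finite (nonzero_lonesum d A)"
    by (rule finite_subset[OF nonzero_lonesum_subset finite_symm_lonesum[OF assms(1)]])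
  have eq: "nonzero_lonesum d A = ?P \<union> (\<Union>p\<in>I. layer d A (fst p) (snd p))"
  proof (intro subset_antisym subsetI)
    fix M assume M: "M \<in> nonzero_lonesum d A"
    show "M \<in> ?P \<union> (\<Union>p\<in>I. layer d A (fst p) (snd p))"
    proof (cases "full_rows A M = A")
      case False
      let ?X = "full_rows A M"
      have "?X \<subseteq> A" by (auto simp: full_rows_def)
      then have "A - ?X \<noteq> {}" using False by blast
      then have "zero_rows (A - ?X) M \<noteq> {}" using zero_rows_nonempty M assms by blast
      moreover have "zero_rows (A - ?X) M \<subseteq> A - ?X" by (auto simp: zero_rows_def)
      moreover have "?X \<noteq> {}" using full_rows_nonempty M assms by blast
      ultimately have "(?X, zero_rows (A - ?X) M) \<in> I" using \<open>?X \<subseteq> A\<close> by (simp add: I_def)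
      moreover have "M \<in> layer d A ?X (zero_rows (A - ?X) M)" using M by (simp add: layer_def)
      ultimately show ?thesis by force
    qed (use M in simp)
  qed (auto simp: layer_def)
  \<comment> \<open>A nonempty \<open>W\<close> inside \<open>A - X\<close> forces
    \<open>X \<noteq> A\<close>.\<close>
  have "?P \<inter> (\<Union>p\<in>I. layer d A (fst p) (snd p)) = {}"
    by (auto simp: layer_def I_def)
  then have "card (nonzero_lonesum d A) = card ?P + card (\<Union>p\<in>I. layer d A (fst p) (snd p))"
    using fin eq by (metis (no_types, lifting) card_Un_disjoint finite_Un)
  also have "card (\<Union>p\<in>I. layer d A (fst p) (snd p)) = (\<Sum>p\<in>I. card (layer d A (fst p) (snd p)))"
  proof (rule card_UN_disjoint[OF finI])
    show "\<forall>p\<in>I. finite (layer d A (fst p) (snd p))"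
      using fin by (auto simp: layer_def)
    show "\<forall>p\<in>I. \<forall>p'\<in>I. p \<noteq> p' \<longrightarrow> layer d A (fst p) (snd p) \<inter> layer d A (fst p') (snd p') = {}"
      by (auto simp: layer_def)
  qed
  also have "\<dots> = (\<Sum>(X, W)\<in>I. card (star d X W) * card (nonzero_lonesum d (A - X - W)))"
  proof (rule sum.cong[OF refl])
    fix p assume "p \<in> I"
    then obtain X W where p: "p = (X, W)" "X \<subseteq> A" "X \<noteq> {}" "W \<subseteq> A - X" "W \<noteq> {}"
      by (auto simp: I_def)
    then interpret peeling d A X W "A - X - W"
      using assms(3) by unfold_locales auto
    show "card (layer d A (fst p) (snd p)) = (case p of (X, W) \<Rightarrow> card (star d X W) * card (nonzero_lonesum d (A - X - W)))"
      using card_layer by (simp add: p(1))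
  qed
  also have "\<dots> = (\<Sum>X\<in>Pow A - {{}}. \<Sum>W\<in>Pow (A - X) - {{}}. card (star d X W) * card (nonzero_lonesum d (A - X - W)))"
    unfolding I_def using assms(1) by (intro sum.Sigma[symmetric]) auto
  finally show ?thesis using card_all_positive[OF assms] by simp
qed

lemma sum_nonempty_subsets_by_card:
  fixes h :: "nat \<Rightarrow> int"
  assumes "finite A"
  shows "(\<Sum>X\<in>Pow A - {{}}. h (card X)) = (\<Sum>k=1..card A. int (card A choose k) * h k)"
proof -
  have "Pow A - {{}} = {X. X \<subseteq> A \<and> card X \<in> {1..card A}}"
    using assms by (auto simp: card_mono Suc_le_eq card_gt_0_iff intro: finite_subset)
  then show ?thesis using sum_subsets_by_card[OF assms, of "{1..card A}" h] by simp
qed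

text \<open>Strong induction on the size of \<open>A\<close>: the recursion over sets
  \<open>X\<close> and \<open>W\<close> depends only on their cardinalities, and grouping by these
  gives \<open>comp_count_rec\<close>.\<close>

lemma card_nonzero_lonesum_eq:
  assumes "finite A" "0 < d"
  shows "int (card (nonzero_lonesum d A)) = comp_count (Suc d) (card A)"
  using assms(1)
proof (induction "card A" arbitrary: A rule: less_induct)
  case less
  show ?case
  proof (cases "A = {}")
    case True
    have "nonzero_lonesum d {} = {\<lambda>_ _. 0}"
      by (auto simp: nonzero_lonesum_def symm_lonesum_def switch_def fun_eq_iff)
    then show ?thesis using True by (simp add: comp_count_0)
  next
    case False
    let ?m = "card A" and ?T = "comp_count (Suc d)"
    have inner: "(\<Sum>W\<in>Pow (A - X) - {{}}. int (card (star d X W) * card (nonzero_lonesum d (A - X - W))))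
        = (\<Sum>b=1..?m - card X. int (?m - card X choose b) * (f_q (Suc d) (card X) b * ?T (?m - card X - b)))"
      if X: "X \<in> Pow A - {{}}" for X
    proof -
      have finX: "finite X" using X less.prems by (auto intro: finite_subset)
      have cX: "card (A - X) = ?m - card X" using X finX by (simp add: card_Diff_subset)
      have "int (card (star d X W) * card (nonzero_lonesum d (A - X - W)))
          = f_q (Suc d) (card X) (card W) * ?T (?m - card X - card W)"
        if W: "W \<in> Pow (A - X) - {{}}" for W
      proof -
        have finW: "finite W" using W less.prems by (auto intro: finite_subset)
        have "card (A - X - W) = ?m - card X - card W"
          using W finW cX by (simp add: card_Diff_subset)
        moreover have "A - X - W \<subset> A" using X by auto
        then have "card (A - X - W) < ?m" using less.prems by (rule psubset_card_mono[rotated])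
        ultimately show ?thesis
          using less.hyps[of "A - X - W"] less.prems star_card[OF finX finW assms(2)] by simp
      qed
      then have "(\<Sum>W\<in>Pow (A - X) - {{}}. int (card (star d X W) * card (nonzero_lonesum d (A - X - W))))
          = (\<Sum>W\<in>Pow (A - X) - {{}}. f_q (Suc d) (card X) (card W) * ?T (?m - card X - card W))"
        by (rule sum.cong[OF refl])
      also have "\<dots> = (\<Sum>b=1..?m - card X. int (?m - card X choose b) * (f_q (Suc d) (card X) b * ?T (?m - card X - b)))"
        using less.prems cX
        by (subst sum_nonempty_subsets_by_card[where h = "\<lambda>b. f_q (Suc d) (card X) b * ?T (?m - card X - b)"]) auto
      finally show ?thesis .
    qed
    have "int (card (nonzero_lonesum d A)) = 1 + int ?m * int (d - 1)
      + (\<Sum>X\<in>Pow A - {{}}. \<Sum>W\<in>Pow (A - X) - {{}}. int (card (star d X W) * card (nonzero_lonesum d (A - X - W))))"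
      using card_nonzero_lonesum[OF less.prems False assms(2)] by simp
    also have "(\<Sum>X\<in>Pow A - {{}}. \<Sum>W\<in>Pow (A - X) - {{}}. int (card (star d X W) * card (nonzero_lonesum d (A - X - W))))
      = (\<Sum>X\<in>Pow A - {{}}. \<Sum>b=1..?m - card X. int (?m - card X choose b) * (f_q (Suc d) (card X) b * ?T (?m - card X - b)))"
      by (rule sum.cong[OF refl inner])
    also have "\<dots> = (\<Sum>a=1..?m. int (?m choose a) *
        (\<Sum>b=1..?m-a. int (?m - a choose b) * (f_q (Suc d) a b * ?T (?m - a - b))))"
      by (rule sum_nonempty_subsets_by_card[OF less.prems])
    also have "1 + int ?m * int (d - 1) + \<dots> = ?T ?m"
      using False less.prems assms(2)
      by (subst comp_count_rec) (auto simp: card_gt_0_iff of_nat_diff algebra_simps)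
    finally show ?thesis .
  qed
qed

section \<open>From matrices without switches to the counting formula\<close>

lemma symmetric_strong_lonesum_eq:
  assumes "0 < d"
  shows "{M. strong_lonesum (Suc d) n n M \<and> (\<forall>i j. M i j = M j i)} = symm_lonesum d {..<n}"
proof (intro subset_antisym subsetI)
  fix M assume "M \<in> {M. strong_lonesum (Suc d) n n M \<and> (\<forall>i j. M i j = M j i)}"
  then have M: "strong_lonesum (Suc d) n n M" and sym: "\<forall>i j. M i j = M j i" by auto
  have q: "M \<in> qary_mats (Suc d) n n" using M by (simp add: strong_lonesum_def)
  then have zero: "\<forall>i j. i \<notin> {..<n} \<or> j \<notin> {..<n} \<longrightarrow> M i j = 0"
    by (simp add: qary_mats_def not_less)
  have le: "M i j \<le> d" for i j
    using q zero[rule_format, of i j] by (cases "i < n \<and> j < n") (auto simp: qary_mats_def less_Suc_eq_le)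
  have less: "a < n \<and> b < n" if "0 < M a b" for a b
    using zero[rule_format, of a b] that by (cases "a < n \<and> b < n") auto
  have "\<not> switch d M i i' j j'" for i i' j j'
  proof
    assume sw: "switch d M i i' j j'"
    \<comment> \<open>The two positive corners already involve all four indices.\<close>
    then have "i < n" "i' < n" "j < n" "j' < n"
      using less[of i' j] less[of i j'] by (auto simp: switch_def)
    then show False using strong_lonesum_no_switch[OF M] sw by simp
  qed
  with le zero sym show "M \<in> symm_lonesum d {..<n}"
    unfolding symm_lonesum_def mem_Collect_eq by (intro conjI allI) blast+
next
  fix M assume M: "M \<in> symm_lonesum d {..<n}"
  have "M i j = 0" if "n \<le> i \<or> n \<le> j" for i j
    using symm_lonesumD(2)[OF M, of i j] that by (cases "M i j = 0") auto
  then have "M \<in> qary_mats (Suc d) n n"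
    using symm_lonesumD(1)[OF M] by (simp add: qary_mats_def less_Suc_eq_le)
  moreover have "\<not> switch d M i i' j j'" for i i' j j' using M by (simp add: symm_lonesum_def)
  ultimately have "strong_lonesum (Suc d) n n M"
    using assms by (intro strong_lonesum_if_no_switch) auto
  then show "M \<in> {M. strong_lonesum (Suc d) n n M \<and> (\<forall>i j. M i j = M j i)}"
    using symm_lonesumD(3)[OF M] by blast
qed

theorem theorem3p7:
  fixes q n :: nat
  assumes "2 \<le> q" and "1 \<le> n"
  shows "int (B n q) = 1 + (\<Sum>j=1..n. \<Sum>ls\<in>S_set n j.
            int (multinomial n ls)
          * (\<Prod>i=1..j div 2. f_q q (ls ! (2*i - 1)) (ls ! (2*i)))
          * (1 + (int q - 2) * (int n - (\<Sum>i=0..2*(j div 2). int (ls ! i)))))"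
proof -
  define d where "d = q - 1"
  have d: "0 < d" "q = Suc d" using assms by (auto simp: d_def)
  have "int (B n q) = (\<Sum>Z\<in>Pow {..<n}. int (card (nonzero_lonesum d Z)))"
    using card_symm_lonesum[of "{..<n}" d] by (simp add: B_def d symmetric_strong_lonesum_eq)
  also have "\<dots> = (\<Sum>Z\<in>Pow {..<n}. comp_count q (card Z))"
    using d by (intro sum.cong refl) (auto intro!: card_nonzero_lonesum_eq intro: finite_subset)
  also have "\<dots> = (\<Sum>Z | Z \<subseteq> {..<n} \<and> card Z \<in> {0..n}. comp_count q (card Z))"
    by (intro sum.cong) (auto intro: card_mono[of "{..<n}", simplified])
  also have "\<dots> = (\<Sum>k=0..n. int (n choose k) * comp_count q k)"
    using sum_subsets_by_card[of "{..<n}" "{0..n}"] by simp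
  \<comment> \<open>Passing from the number of nonzero rows to the number of zero rows, which is the
    first entry of the lists in \<open>S_set\<close>.\<close>
  also have "\<dots> = (\<Sum>k=0..n. int (n choose k) * comp_count q (n - k))"
    by (rule sum.reindex_bij_witness[where i = "\<lambda>k. n - k" and j = "\<lambda>k. n - k"])
      (auto simp: binomial_symmetric[symmetric])
  also note multinomial_sum_eq_comp_count[symmetric]
  finally show ?thesis .
qed

end
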